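(* Let $q=2^h$ with $h\geq 3$, and let $\alpha,\beta\in\mathbb{F}_{q^2}^{*}$. Let $$f_{\alpha,\beta}(x)=x+\alpha x^{q(q-1)+1}+\beta x^{2(q-1)+1}\in\mathbb{F}_{q^2}[x].$$ Then $f_{\alpha,\beta}$ is a permutation of $\mathbb{F}_{q^2}$ if and only if one of the following holds: \begin{enumerate} \item $\beta=\alpha^{q-1}$ and $Tr\left(1+\frac{1}{\alpha^{q+1}}\right)=0$; \item $\beta(1+\alpha^{q+1}+\beta^{q+1})+\alpha^{2q}=0$, $\beta^{q+1}\neq 1$, and $Tr\left(\frac{\beta^{q+1}}{\alpha^{q+1}}\right)=0$. \end{enumerate}
   Context: $Tr:\mathbb{F}_q\to\mathbb{F}_2$ denotes the absolute trace, $Tr(z)=z+z^2+z^{2^2}+\cdots+z^{2^{h-1}}$. Note that $\alpha^{q+1},\beta^{q+1}\in\mathbb{F}_q$. A permutation of $\mathbb{F}_{q^2}$ means the map $x\mapsto f_{\alpha,\beta}(x)$ is a bijection of $\mathbb{F}_{q^2}$. *)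

theory Defs
  imports Main
begin

text \<open>Absolute trace from F_q (q = 2^h) to F_2, written inside the ambient field:
  Tr(z) = z + z^2 + ... + z^(2^(h-1)).\<close>
definition abs_trace :: "nat \<Rightarrow> 'a::comm_ring_1 \<Rightarrow> 'a" where
  "abs_trace h z = (\<Sum>i<h. z ^ (2 ^ i))"

end

theory Submission
  imports Defs "HOL-Number_Theory.Residues" "HOL-Computational_Algebra.Polynomial"
begin

text \<open>
  Since \<open>f (c * x) = c * f x\<close> for \<open>c\<close> in F_q, \<open>f\<close> is bijective iff the rational function
  \<open>N / D\<close> of degree 3 with \<open>f x ^ (q - 1) = N u / D u\<close>, \<open>u = x ^ (q - 1)\<close>, is injective on the
  group \<open>mu\<close> of \<open>(q + 1)\<close>-th roots of unity and \<open>D\<close> has no zero there. After a rescaling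
  \<open>\<alpha> = A\<close> lies in F_q. Dividing \<open>N u * D v - N v * D u\<close> by \<open>u - v\<close> leaves, for fixed \<open>u\<close> and
  \<open>v = u * x\<close>, an equation \<open>g * x + g ^ q / x + b = 0\<close> for \<open>x\<close> in \<open>mu\<close>. For \<open>b \<noteq> 0\<close> it is
  unsolvable iff \<open>g ^ (q + 1) / b\<^sup>2\<close> has trace 0.

  Bijectivity thus means that a rational function of \<open>u\<close> has trace 0 at every point of \<open>mu\<close>
  where \<open>b \<noteq> 0\<close>, with a side condition at the zeros of \<open>b\<close>. If these zeros \<open>w\<close>, \<open>1 / w\<close> lie in
  \<open>mu\<close>, the side condition forces \<open>B = \<beta>\<close> into F_q, with
  \<open>B * (1 + A\<^sup>2 + B\<^sup>2) = A\<^sup>2\<close>. Otherwise they lie in F_q, and a Moebius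
  transformation of \<open>mu\<close> moves them to 0 and \<open>\<infinity>\<close>, so that the function becomes a Laurent
  polynomial with exponents -2, ..., 2. Its trace is a polynomial of degree at most \<open>q\<close> up to a
  monomial factor, and has to vanish identically because it has \<open>q + 1\<close> roots: no estimate of the
  number of points on a curve is needed.
\<close>

lemma power_card_UNIV:
  fixes x :: "'a::{field,finite}"
  shows "x ^ card (UNIV :: 'a set) = x"
proof (cases "x = 0")
  case True
  then show ?thesis by (simp add: power_0_left finite_UNIV_card_ge_0)
next
  case False
  let ?U = "UNIV - {0} :: 'a set"
  have "(\<Prod>y\<in>?U. y) = (\<Prod>y\<in>?U. x * y)"
    by (rule prod.reindex_bij_witness[of _ "\<lambda>y. x * y" "\<lambda>y. y / x"]) (use False in auto)
  then have "(\<Prod>y\<in>?U. y) = x ^ card ?U * (\<Prod>y\<in>?U. y)"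
    by (simp add: prod.distrib)
  moreover have "(\<Prod>y\<in>?U. y) \<noteq> 0"
    by simp
  ultimately have "x ^ card ?U = 1"
    by simp
  moreover have "card (UNIV :: 'a set) = Suc (card ?U)"
    using card.remove[of "UNIV :: 'a set" 0] by simp
  ultimately show ?thesis
    by (simp only: power_Suc mult_1_right)
qed

section \<open>Quadratic extensions of finite fields of characteristic 2\<close>

locale quadratic_ext_char_2 =
  fixes h :: nat and ty :: "'a::{field,finite} itself"
  assumes card_UNIV: "card (UNIV :: 'a set) = (2 ^ h) ^ 2"
    and h_pos: "h > 0"
begin

lemma char_2: "CHAR('a) = 2"
proof -
  have "CHAR('a) > 0"
    by (simp add: finite_imp_CHAR_pos)
  then have "prime CHAR('a)"
    by (rule prime_CHAR_semidom)
  moreover have "CHAR('a) dvd 2 ^ (h * 2)"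
    using CHAR_dvd_CARD[where 'a='a] by (simp add: card_UNIV power_mult)
  ultimately show ?thesis
    by (metis prime_dvd_power primes_dvd_imp_eq two_is_prime_nat)
qed

lemma one_plus_one: "(1::'a) + 1 = 0"
  using of_nat_CHAR[where 'a='a] by (simp add: char_2)

lemma add_self: "(x::'a) + x = 0"
  using arg_cong[OF one_plus_one, of "\<lambda>t. x * t"] by (simp add: algebra_simps)

lemma add_self_left: "(x::'a) + (x + y) = y"
  by (simp add: add.assoc[symmetric] add_self)

lemma two_eq_zero: "(2::'a) = 0"
  using one_plus_one by simp

lemmas char_2_simps =
  algebra_simps power2_eq_square power3_eq_cube add_self add_self_left two_eq_zero

lemma minus_eq: "- (x::'a) = x"
  by (metis add_self add_eq_0_iff)

lemma diff_eq: "(x::'a) - y = x + y"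
  by (metis diff_conv_add_uminus minus_eq)

lemma add_eq_0_iff_eq: "(x::'a) + y = 0 \<longleftrightarrow> x = y"
  by (metis diff_eq right_minus_eq)

lemma add_swap: "(x::'a) + y = z + t \<longleftrightarrow> x + z = y + t"
proof -
  have "x + y = z + t \<longleftrightarrow> (x + y) + (z + t) = 0"
    by (rule add_eq_0_iff_eq[symmetric])
  also have "(x + y) + (z + t) = (x + z) + (y + t)"
    by (simp only: ac_simps)
  finally show ?thesis
    by (simp only: add_eq_0_iff_eq)
qed

lemma add_power2: "((x::'a) + y)\<^sup>2 = x\<^sup>2 + y\<^sup>2"
  by (rule freshmans_dream) (simp_all add: char_2)

lemma add_power_power2: "((x::'a) + y) ^ 2 ^ n = x ^ 2 ^ n + y ^ 2 ^ n"
  by (rule freshmans_dream') (simp_all add: char_2)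

text \<open>The Frobenius automorphism over F_q. The subfield is its fixed set, so membership in F_q
  is written \<open>conjg x = x\<close> throughout.\<close>

definition conjg :: "'a \<Rightarrow> 'a" where
  "conjg x = x ^ 2 ^ h"

lemma conjg_add: "conjg (x + y) = conjg x + conjg y"
  by (simp add: conjg_def add_power_power2)

lemma conjg_mult: "conjg (x * y) = conjg x * conjg y"
  by (simp add: conjg_def power_mult_distrib)

lemma conjg_divide: "conjg (x / y) = conjg x / conjg y"
  by (simp add: conjg_def power_divide)

lemma conjg_power: "conjg (x ^ n) = conjg x ^ n"
  by (simp add: conjg_def power_mult[symmetric] mult.commute)

lemma conjg_0: "conjg 0 = 0"
  by (simp add: conjg_def)

lemma conjg_1: "conjg 1 = 1"
  by (simp add: conjg_def)

lemma conjg_eq_0_iff: "conjg x = 0 \<longleftrightarrow> x = 0"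
  by (simp add: conjg_def)

lemma conjg_conjg: "conjg (conjg x) = x"
  using power_card_UNIV[of x]
  by (simp add: conjg_def card_UNIV power_mult[symmetric] power2_eq_square)

lemmas conjg_simps = conjg_add conjg_mult conjg_divide conjg_power conjg_0 conjg_1 conjg_conjg conjg_eq_0_iff

lemma power_q_minus_1: "x \<noteq> 0 \<Longrightarrow> x ^ (2 ^ h - 1) = conjg x / x"
  by (simp add: conjg_def power_diff)

lemma ex_sqrt: "\<exists>s::'a. s\<^sup>2 = x"
proof
  have "2 ^ (2 * h - 1) * 2 = ((2 ^ h)\<^sup>2 :: nat)"
    by (simp add: power_mult[symmetric] mult.commute h_pos flip: power_Suc)
  then show "(x ^ 2 ^ (2 * h - 1))\<^sup>2 = x"
    using power_card_UNIV[of x] by (simp add: card_UNIV power_mult[symmetric])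
qed

lemma power2_eq_iff: "(x::'a)\<^sup>2 = y\<^sup>2 \<longleftrightarrow> x = y"
  by (metis add_power2 add_eq_0_iff_eq zero_eq_power2)

section \<open>The norm-one group of F_(q^2) over F_q\<close>

definition mu :: "'a set" where
  "mu = {x. x * conjg x = 1}"

lemma mu_conjg: "x \<in> mu \<Longrightarrow> conjg x = 1 / x"
  by (auto simp: mu_def eq_divide_eq mult.commute)

lemma mu_divide: "x \<in> mu \<Longrightarrow> y / x = y * conjg x"
  by (simp add: mu_conjg)

lemma mu_nonzero: "x \<in> mu \<Longrightarrow> x \<noteq> 0"
  by (auto simp: mu_def)

lemma one_in_mu: "1 \<in> mu"
  by (simp add: mu_def conjg_1)

lemma mult_in_mu: "x \<in> mu \<Longrightarrow> y \<in> mu \<Longrightarrow> x * y \<in> mu"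
  using mu_conjg[of x] mu_conjg[of y] mu_nonzero[of x] mu_nonzero[of y]
  by (simp add: mu_def conjg_mult)

lemma inverse_in_mu: "x \<in> mu \<Longrightarrow> 1 / x \<in> mu"
  by (auto simp: mu_def conjg_simps)

text \<open>Every nonzero \<open>x\<close> outside \<open>mu\<close> is a root of \<open>(X ^ (q\<^sup>2 - 1) - 1) / (X ^ (q + 1) - 1)\<close>.\<close>

lemma card_mu: "2 ^ h < card mu"
proof -
  let ?q = "2 ^ h :: nat"
  have q2: "?q \<ge> 2"
    using h_pos by (cases h) auto
  define p :: "'a poly" where "p = (\<Sum>j<?q - 1. monom 1 ((?q + 1) * j))"
  have "coeff p 0 = (\<Sum>j<?q - 1. if j = 0 then 1 else 0)"
    unfolding p_def coeff_sum by (intro sum.cong) auto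
  also have "\<dots> = 1"
    using q2 by (subst sum.delta) auto
  finally have "p \<noteq> 0"
    by auto
  have deg: "degree p \<le> (?q + 1) * (?q - 2)"
    unfolding p_def
  proof (rule degree_sum_le)
    fix j assume "j \<in> {..<?q - 1}"
    then have "(?q + 1) * j \<le> (?q + 1) * (?q - 2)"
      by (intro mult_left_mono) auto
    then show "degree (monom (1::'a) ((?q + 1) * j)) \<le> (?q + 1) * (?q - 2)"
      using degree_monom_le order_trans by blast
  qed simp
  have root: "poly p x = 0" if "x \<noteq> 0" "x \<notin> mu" for x
  proof -
    let ?y = "x ^ (?q + 1)"
    have "?y ^ (?q - 1) * x = x"
    proof -
      have "(?q + 1) * (?q - 1) + 1 = ?q\<^sup>2"
        using q2 by (simp add: algebra_simps power2_eq_square)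
      then show ?thesis
        using power_card_UNIV[of x] unfolding card_UNIV
        by (metis power_add power_mult power_one_right)
    qed
    with that have "?y ^ (?q - 1) = 1"
      by simp
    moreover have "?y \<noteq> 1"
      using that by (auto simp: mu_def conjg_def)
    moreover have "poly p x = (\<Sum>j<?q - 1. ?y ^ j)"
      by (simp only: p_def poly_sum poly_monom power_mult mult_1)
    ultimately show ?thesis
      by (simp add: geometric_sum)
  qed
  have "?q\<^sup>2 = card (UNIV :: 'a set)"
    by (simp add: card_UNIV)
  also have "\<dots> \<le> card (insert 0 (mu \<union> {x. poly p x = 0}))"
    using root by (intro card_mono) auto
  also have "\<dots> \<le> Suc (card (mu \<union> {x. poly p x = 0}))"
    by (rule card_insert_le_m1) auto
  also have "\<dots> \<le> Suc (card mu + card {x. poly p x = 0})"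
    using card_Un_le by simp
  also have "card {x. poly p x = 0} \<le> (?q + 1) * (?q - 2)"
    using card_poly_roots_bound[OF \<open>p \<noteq> 0\<close>] deg by (rule order_trans)
  finally have "?q\<^sup>2 \<le> Suc (card mu + (?q + 1) * (?q - 2))"
    by simp
  \<comment> \<open>Removing 0 and at most \<open>(q + 1) * (q - 2)\<close> roots from
    \<open>q^2\<close> elements leaves at least \<open>q + 1\<close> of them for
    \<open>mu\<close>.\<close>
  moreover have "?q\<^sup>2 = Suc (Suc ?q + (?q + 1) * (?q - 2))"
  proof -
    have "n\<^sup>2 = Suc (Suc n + (n + 1) * (n - 2))" if n: "n \<ge> 2" for n :: nat
    proof -
      obtain k where "n = 2 + k"
        using le_Suc_ex[OF n] by auto
      then show ?thesis
        by (simp add: power2_eq_square)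
    qed
    then show ?thesis
      using q2 .
  qed
  ultimately show ?thesis
    by (metis Suc_le_eq add_le_cancel_right Suc_le_mono)
qed

lemma ex_mu_neq: "\<exists>v\<in>mu. v \<noteq> u"
proof (rule ccontr)
  assume "\<not> ?thesis"
  then have "mu \<subseteq> {u}"
    by auto
  then have "card mu \<le> 1"
    using card_mono[of "{u}" mu] by simp
  moreover have "(1::nat) \<le> 2 ^ h"
    by simp
  ultimately show False
    using card_mu by linarith
qed

text \<open>Explicit Hilbert 90: the conjugate of \<open>1 + 1 / u\<close> is \<open>1 + u\<close>,
  which is \<open>u\<close> times it. This witness vanishes exactly at \<open>u = 1\<close>, hence
  the case split.\<close>

lemma mu_hilbert90:
  assumes "u \<in> mu"
  obtains x where "x \<noteq> 0" "x ^ (2 ^ h - 1) = u"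
proof (cases "u = 1")
  case True
  then show ?thesis
    using that[of 1] by simp
next
  case False
  let ?x = "1 + 1 / u"
  have u: "u \<noteq> 0" "conjg u = 1 / u"
    using assms by (auto simp: mu_nonzero mu_conjg)
  have x: "?x \<noteq> 0"
    using False u by (simp add: add_eq_0_iff_eq)
  have "?x ^ (2 ^ h - 1) = conjg ?x / ?x"
    using x by (rule power_q_minus_1)
  also have "conjg ?x = ?x * u"
    using u by (simp add: conjg_simps field_simps)
  finally show ?thesis
    using that x by simp
qed

lemma power_q_minus_1_in_mu: "x \<noteq> 0 \<Longrightarrow> x ^ (2 ^ h - 1) \<in> mu"
  by (subst power_q_minus_1) (simp_all add: mu_def conjg_divide conjg_conjg conjg_eq_0_iff)

section \<open>The absolute trace and Artin-Schreier equations\<close>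

lemma abs_trace_add: "abs_trace n ((x::'a) + y) = abs_trace n x + abs_trace n y"
  by (simp add: abs_trace_def add_power_power2 sum.distrib)

lemma abs_trace_artin_schreier: "abs_trace n ((z::'a)\<^sup>2 + z) = z ^ 2 ^ n + z"
  unfolding abs_trace_def
  by (induction n)
    (simp_all add: add_power_power2 power_mult[symmetric] add_self add_self_left ac_simps)

text \<open>The map \<open>z^2 + z\<close> is at most two-to-one, so its range has at least half as
  many elements as the field. The range consists of roots of the trace polynomial to F_2, which has
  at most that many, so the two sets agree. Telescoping then gives \<open>conjg z + z\<close>: the
  trace of \<open>c\<close> decides whether the root \<open>z\<close> lies in F_q.\<close>

lemma ex_artin_schreier_root:
  assumes "conjg c = c"
  shows "\<exists>z. z\<^sup>2 + z = c \<and> conjg z + z = abs_trace h c"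
proof -
  let ?n = "2 * h" and ?S = "\<lambda>z::'a. z\<^sup>2 + z"
  define p :: "'a poly" where "p = (\<Sum>i<?n. monom 1 (2 ^ i))"
  have poly_p: "poly p x = abs_trace ?n x" for x
    by (simp add: p_def poly_sum poly_monom abs_trace_def)
  have "coeff p 1 = (\<Sum>i<?n. if i = 0 then 1 else 0)"
    unfolding p_def coeff_sum by (intro sum.cong) auto
  also have "\<dots> = 1"
    using h_pos by (subst sum.delta) auto
  finally have "p \<noteq> 0"
    by auto
  have deg: "degree p \<le> 2 ^ (?n - 1)"
    unfolding p_def
  proof (rule degree_sum_le)
    fix i assume "i \<in> {..<?n}"
    then have "(2::nat) ^ i \<le> 2 ^ (?n - 1)"
      by (intro power_increasing) auto
    then show "degree (monom (1::'a) (2 ^ i)) \<le> 2 ^ (?n - 1)"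
      using degree_monom_le order_trans by blast
  qed simp
  have card_roots: "card {x. poly p x = 0} \<le> 2 ^ (?n - 1)"
    using card_poly_roots_bound[OF \<open>p \<noteq> 0\<close>] deg by (rule order_trans)
  have "abs_trace ?n (?S z) = 0" for z
    using abs_trace_artin_schreier[of ?n z] power_card_UNIV[of z]
    by (simp add: card_UNIV add_self power_mult[symmetric] mult.commute)
  then have range: "range ?S \<subseteq> {x. poly p x = 0}"
    by (auto simp: poly_p)
  have "card (UNIV :: 'a set) = card (\<Union>y\<in>range ?S. {z. ?S z = y})"
    by (rule arg_cong[where f=card]) auto
  also have "\<dots> \<le> (\<Sum>y\<in>range ?S. card {z. ?S z = y})"
    by (rule card_UN_le) simp
  also have "\<dots> \<le> (\<Sum>y\<in>range ?S. 2)"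
  proof (rule sum_mono)
    fix y assume "y \<in> range ?S"
    then obtain z0 where z0: "y = ?S z0"
      by auto
    have "{z. ?S z = y} \<subseteq> {z0, z0 + 1}"
    proof
      fix z assume "z \<in> {z. ?S z = y}"
      then have "?S z + ?S z0 = 0"
        by (simp add: z0 add_self)
      then have "(z + z0) * (z + (z0 + 1)) = 0"
        by (simp add: algebra_simps power2_eq_square add_self add_self_left)
      then show "z \<in> {z0, z0 + 1}"
        by (simp add: add_eq_0_iff_eq)
    qed
    then have "card {z. ?S z = y} \<le> card {z0, z0 + 1}"
      by (intro card_mono) auto
    also have "\<dots> \<le> 2"
      by (simp add: card_insert_if)
    finally show "card {z. ?S z = y} \<le> 2" .
  qed
  finally have "2 ^ ?n \<le> 2 * card (range ?S)"
    by (simp add: card_UNIV power_mult[symmetric] mult.commute)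
  moreover have "(2::nat) ^ ?n = 2 * 2 ^ (?n - 1)"
    using h_pos by (simp flip: power_Suc)
  ultimately have "card {x. poly p x = 0} \<le> card (range ?S)"
    using card_roots by linarith
  then have "range ?S = {x. poly p x = 0}"
    using range by (intro card_seteq) auto
  moreover have "poly p c = 0"
  proof -
    \<comment> \<open>The trace over \<open>2 * h\<close> terms splits into two halves, which
      coincide for \<open>c\<close> in F_q and cancel.\<close>
    have "abs_trace ?n c = (\<Sum>i<h. c ^ 2 ^ i) + (\<Sum>i<h. c ^ 2 ^ (h + i))"
      by (simp add: abs_trace_def mult_2 lessThan_atLeast0 sum.atLeastLessThan_concat[of 0 h "h + h", symmetric] sum.shift_bounds_nat_ivl[of _ 0 h h, simplified] add.commute)
    also have "(\<Sum>i<h. c ^ 2 ^ (h + i)) = (\<Sum>i<h. c ^ 2 ^ i)"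
      using assms by (simp add: conjg_def power_add power_mult)
    finally show ?thesis
      by (simp add: poly_p add_self)
  qed
  ultimately have "c \<in> range ?S"
    by simp
  then obtain z where "c = ?S z"
    by auto
  then show ?thesis
    using abs_trace_artin_schreier[of h z] by (auto simp: conjg_def)
qed


text \<open>For an Artin-Schreier root \<open>z\<close> of \<open>c\<close>, the element
  \<open>conjg z + z\<close> is itself a root of \<open>t^2 + t\<close>.\<close>

lemma abs_trace_dichotomy:
  assumes "conjg c = c"
  shows "abs_trace h c = 0 \<or> abs_trace h c = 1"
proof -
  obtain z where z: "z\<^sup>2 + z = c" "conjg z + z = abs_trace h c"
    using ex_artin_schreier_root[OF assms] by blast
  have "(conjg z + z)\<^sup>2 + (conjg z + z) = conjg c + c"
    by (simp add: conjg_simps add_power2 ac_simps flip: z(1))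
  also have "\<dots> = 0"
    by (simp add: assms add_self)
  finally have "abs_trace h c * (abs_trace h c + 1) = 0"
    by (simp only: z(2) power2_eq_square distrib_left mult_1_right)
  then show ?thesis
    by (auto simp: add_eq_0_iff_eq)
qed

lemma abs_trace_square_add_self:
  assumes "conjg t = t"
  shows "abs_trace h (t\<^sup>2 + t) = 0"
  using assms by (simp add: abs_trace_artin_schreier add_self flip: conjg_def)

lemma abs_trace_square:
  assumes "conjg t = t"
  shows "abs_trace h (t\<^sup>2) = abs_trace h t"
  using abs_trace_square_add_self[OF assms] by (simp add: abs_trace_add add_eq_0_iff_eq)

section \<open>Laurent polynomials whose trace vanishes on \<open>mu\<close>\<close>

text \<open>Multiplication by \<open>y ^ 2 ^ (h - 1)\<close> clears the denominators of the trace
  and keeps the degree within \<open>q\<close>, so having all of \<open>mu\<close> as roots forces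
  the zero polynomial.\<close>

lemma abs_trace_linear_on_mu:
  assumes tr: "\<And>y. y \<in> mu \<Longrightarrow> abs_trace h (c0 + c * y + d / y) = 0"
  shows "c = 0"
proof -
  let ?m = "2 ^ (h - 1) :: nat"
  have m: "2 * ?m = 2 ^ h"
    using h_pos by (simp flip: power_Suc)
  have le_m: "2 ^ i \<le> ?m" if "i < h" for i
    using that by (intro power_increasing) auto
  define p where "p = (\<Sum>i<h. monom (c0 ^ 2 ^ i) ?m + monom (c ^ 2 ^ i) (?m + 2 ^ i)
    + monom (d ^ 2 ^ i) (?m - 2 ^ i))"
  have deg: "degree p \<le> 2 ^ h"
    unfolding p_def
  proof (intro degree_sum_le degree_add_le)
    fix i assume "i \<in> {..<h}"
    then have i: "2 ^ i \<le> ?m"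
      using le_m by simp
    then show "degree (monom (c0 ^ 2 ^ i) ?m) \<le> 2 ^ h"
      "degree (monom (c ^ 2 ^ i) (?m + 2 ^ i)) \<le> 2 ^ h"
      "degree (monom (d ^ 2 ^ i) (?m - 2 ^ i)) \<le> 2 ^ h"
      using m i by (linarith | intro order_trans[OF degree_monom_le])+
  qed simp
  have root: "poly p y = 0" if "y \<in> mu" for y
  proof -
    have "y ^ (?m - 2 ^ i) = y ^ ?m / y ^ 2 ^ i" if "i < h" for i
      using le_m[OF that] mu_nonzero[OF \<open>y \<in> mu\<close>] by (rule power_diff[rotated])
    then have "poly p y = (\<Sum>i<h. y ^ ?m * (c0 + c * y + d / y) ^ 2 ^ i)"
      by (simp add: p_def poly_sum poly_monom add_power_power2 power_add power_mult_distrib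
          power_divide algebra_simps)
    also have "\<dots> = y ^ ?m * abs_trace h (c0 + c * y + d / y)"
      by (simp add: abs_trace_def sum_distrib_left)
    finally show ?thesis
      using tr[OF that] by simp
  qed
  have "p = 0"
  proof (rule ccontr)
    assume "p \<noteq> 0"
    have "card mu \<le> card {x. poly p x = 0}"
      using root by (intro card_mono) auto
    also have "\<dots> \<le> degree p"
      using \<open>p \<noteq> 0\<close> by (rule card_poly_roots_bound)
    finally show False
      using deg card_mu by simp
  qed
  \<comment> \<open>Only the summand \<open>i = 0\<close> reaches this exponent, so \<open>c\<close>
    occurs here without a Frobenius power.\<close>
  have "coeff p (?m + 1) = (\<Sum>i<h. if i = 0 then c else 0)"
    unfolding p_def coeff_sum by (intro sum.cong) auto
  also have "\<dots> = c"
    using h_pos by simp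
  finally show ?thesis
    using \<open>p = 0\<close> by simp
qed

lemma abs_trace_quadratic_on_mu:
  assumes tr: "\<And>y. y \<in> mu \<Longrightarrow>
    abs_trace h (c0 + c1 * y + conjg c1 / y + c2 * y\<^sup>2 + conjg c2 / y\<^sup>2) = 0"
  shows "c1\<^sup>2 = c2"
proof -
  obtain s where s: "s\<^sup>2 = c2"
    using ex_sqrt by blast
  txt \<open>A square has the same trace as its root, so the quadratic terms merge with the linear ones.\<close>
  have "c1 + s = 0"
  proof (rule abs_trace_linear_on_mu)
    fix y assume y: "y \<in> mu"
    let ?t = "s * y + conjg s / y"
    have "conjg ?t = ?t"
      using mu_conjg[OF y] by (simp add: conjg_simps add.commute)
    then have "abs_trace h (?t\<^sup>2) = abs_trace h ?t"
      by (rule abs_trace_square)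
    moreover have "c2 * y\<^sup>2 + conjg c2 / y\<^sup>2 = ?t\<^sup>2"
      by (simp add: add_power2 power_mult_distrib power_divide conjg_simps flip: s)
    ultimately have "abs_trace h (c2 * y\<^sup>2 + conjg c2 / y\<^sup>2) = abs_trace h ?t"
      by simp
    then have "abs_trace h (c0 + (c1 + s) * y + (conjg c1 + conjg s) / y)
      = abs_trace h (c0 + c1 * y + conjg c1 / y + (c2 * y\<^sup>2 + conjg c2 / y\<^sup>2))"
      by (simp add: abs_trace_add add_divide_distrib algebra_simps)
    then show "abs_trace h (c0 + (c1 + s) * y + (conjg c1 + conjg s) / y) = 0"
      using tr[OF y] by (simp add: add.assoc)
  qed
  then show ?thesis
    using s by (simp add: add_eq_0_iff_eq)
qed

section \<open>Solvability of \<open>g * x + conjg g / x + b = 0\<close> in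
  \<open>mu\<close>\<close>

text \<open>For \<open>g\<close> nonzero the equation reads \<open>x^2 = conjg g / g\<close>. Its
  unique root has norm one, so it lies in \<open>mu\<close>, and it is the excluded value 1 exactly
  when \<open>g\<close> is in F_q.\<close>

lemma conjugate_equation_on_mu_zero:
  "(\<forall>x\<in>mu. x \<noteq> 1 \<longrightarrow> g * x + conjg g / x \<noteq> 0) \<longleftrightarrow> g \<noteq> 0 \<and> conjg g = g"
proof (intro iffI conjI)
  assume L: "\<forall>x\<in>mu. x \<noteq> 1 \<longrightarrow> g * x + conjg g / x \<noteq> 0"
  show g: "g \<noteq> 0"
    using L ex_mu_neq[of 1] by (auto simp: conjg_0)
  obtain x where x: "x\<^sup>2 = conjg g / g"
    using ex_sqrt by blast
  have "(x * conjg x)\<^sup>2 = x\<^sup>2 * conjg (x\<^sup>2)"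
    by (simp add: power_mult_distrib conjg_power)
  also have "\<dots> = 1\<^sup>2"
    using g by (simp add: x conjg_simps)
  finally have "x \<in> mu"
    by (simp only: power2_eq_iff mu_def mem_Collect_eq)
  moreover have "g * x + conjg g / x = 0"
    using x g mu_nonzero[OF \<open>x \<in> mu\<close>]
    by (simp add: add_eq_0_iff_eq field_simps power2_eq_square two_eq_zero)
  ultimately have "x = 1"
    using L by blast
  then show "conjg g = g"
    using x g by simp
next
  assume R: "g \<noteq> 0 \<and> conjg g = g"
  show "\<forall>x\<in>mu. x \<noteq> 1 \<longrightarrow> g * x + conjg g / x \<noteq> 0"
  proof (intro ballI impI notI)
    fix x assume x: "x \<in> mu" "x \<noteq> 1" "g * x + conjg g / x = 0"
    then have "x\<^sup>2 = 1\<^sup>2"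
      using R mu_nonzero[of x] by (simp add: add_eq_0_iff_eq field_simps power2_eq_square)
    then show False
      using x by (simp only: power2_eq_iff)
  qed
qed

text \<open>The substitution \<open>z = g * x / b\<close> turns a solution in \<open>mu\<close> into
  an Artin-Schreier root \<open>z\<close> of \<open>g * conjg g / b^2\<close> with
  \<open>conjg z = z + 1\<close>, which means trace 1. Conversely, trace 1 yields such roots and
  they lead back to solutions.\<close>

lemma conjugate_equation_on_mu_nonzero:
  assumes b: "b \<noteq> 0" "conjg b = b"
  shows "(\<forall>x\<in>mu. x \<noteq> 1 \<longrightarrow> g * x + conjg g / x + b \<noteq> 0)
    \<longleftrightarrow> abs_trace h (g * conjg g / b\<^sup>2) = 0"
proof (rule iffI)
  assume L: "\<forall>x\<in>mu. x \<noteq> 1 \<longrightarrow> g * x + conjg g / x + b \<noteq> 0"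
  let ?c = "g * conjg g / b\<^sup>2"
  have c: "conjg ?c = ?c"
    using b by (simp add: conjg_simps mult.commute)
  obtain z where z: "z\<^sup>2 + z = ?c" "conjg z + z = abs_trace h ?c"
    using ex_artin_schreier_root[OF c] by blast
  show "abs_trace h ?c = 0"
  proof (rule ccontr)
    assume "abs_trace h ?c \<noteq> 0"
    then have "conjg z + z = 1"
      using abs_trace_dichotomy[OF c] z(2) by simp
    then have cz: "conjg z = z + 1"
      by (metis add.assoc add.commute add_self add.right_neutral)
    have g: "g \<noteq> 0"
    proof
      assume "g = 0"
      then have "z * (z + 1) = 0"
        using z(1) by (simp add: power2_eq_square algebra_simps)
      then have "z = 0 \<or> z = 1"
        by (auto simp: add_eq_0_iff_eq)
      then show False
        using cz by (auto simp: conjg_0 conjg_1 add_self)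
    qed
    have prod: "z * (z + 1) * b\<^sup>2 = g * conjg g"
      using z(1) b by (simp add: field_simps power2_eq_square)
    \<comment> \<open>Both roots \<open>z\<close> and \<open>z + 1\<close> give solutions in
      \<open>mu\<close>. The assumption tolerates only the solution 1, but the two are
      distinct.\<close>
    have no_root: "b * w / g = 1" if w: "w = z \<or> w = z + 1" for w
    proof -
      have cw: "conjg w = w + 1" "w * (w + 1) = z * (z + 1)"
        using w cz by (auto simp: conjg_simps add.assoc add_self mult.commute)
      have "(b * w / g) * conjg (b * w / g) = w * (w + 1) * b\<^sup>2 / (g * conjg g)"
        using cw(1) b by (simp add: conjg_simps power2_eq_square)
      also have "\<dots> = 1"
        using prod cw(2) g by (simp add: conjg_eq_0_iff)
      finally have mu: "b * w / g \<in> mu"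
        by (simp add: mu_def)
      have "conjg g / (b * w / g) = conjg (g * (b * w / g))"
        by (simp only: mu_divide[OF mu] conjg_mult)
      also have "\<dots> = b * (w + 1)"
        using g b cw by (simp add: conjg_simps)
      finally have "g * (b * w / g) + conjg g / (b * w / g) + b = 0"
        using g by (simp add: algebra_simps add_self add_self_left)
      then show ?thesis
        using L mu by blast
    qed
    have "b * z / g = b * (z + 1) / g"
      using no_root[of z] no_root[of "z + 1"] by simp
    then show False
      using b g by simp
  qed
next
  assume R: "abs_trace h (g * conjg g / b\<^sup>2) = 0"
  show "\<forall>x\<in>mu. x \<noteq> 1 \<longrightarrow> g * x + conjg g / x + b \<noteq> 0"
  proof (intro ballI impI notI)
    fix x assume x: "x \<in> mu" "x \<noteq> 1" "g * x + conjg g / x + b = 0"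
    let ?z = "g * x / b"
    have "conjg ?z = (conjg g / x) / b"
      using b mu_conjg[OF x(1)] by (simp add: conjg_simps)
    also have "conjg g / x = g * x + b"
      using x(3) by (metis add.commute add.left_commute add_eq_0_iff_eq)
    finally have cz: "conjg ?z = ?z + 1"
      using b by (simp add: add_divide_distrib)
    have "?z\<^sup>2 + ?z = ?z * conjg ?z"
      by (simp only: cz power2_eq_square distrib_left mult_1_right)
    also have "\<dots> = g * conjg g / b\<^sup>2"
      using b mu_conjg[OF x(1)] mu_nonzero[OF x(1)] by (simp add: conjg_simps power2_eq_square)
    finally have "abs_trace h (g * conjg g / b\<^sup>2) = conjg ?z + ?z"
      using abs_trace_artin_schreier[of h ?z] by (simp add: conjg_def)
    also have "\<dots> = 1"
      by (simp only: cz) (simp add: add_self_left add_self add.assoc add.left_commute add.commute)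
    finally show False
      using R by simp
  qed
qed


section \<open>Reduction to the roots of unity\<close>

definition trinomial :: "'a \<Rightarrow> 'a \<Rightarrow> 'a \<Rightarrow> 'a" where
  "trinomial a b x = x + a * x ^ (2 ^ h * (2 ^ h - 1) + 1) + b * x ^ (2 * (2 ^ h - 1) + 1)"

lemma trinomial_alt:
  "trinomial a b x = x * (1 + a * conjg (x ^ (2 ^ h - 1)) + b * (x ^ (2 ^ h - 1))\<^sup>2)"
proof -
  have 1: "x ^ (2 ^ h * (2 ^ h - 1) + 1) = x * conjg (x ^ (2 ^ h - 1))"
    by (simp only: conjg_def power_add power_mult[symmetric] power_one_right mult.commute)
  have 2: "x ^ (2 * (2 ^ h - 1) + 1) = x * (x ^ (2 ^ h - 1))\<^sup>2"
    by (simp only: power_add power_mult[symmetric] power_one_right mult.commute)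
  show ?thesis
    unfolding trinomial_def 1 2
    by (simp only: distrib_left mult_1_right mult.left_commute mult.assoc)
qed

text \<open>Two uses: for \<open>c\<close> in F_q the factor \<open>r\<close> is 1, so the trinomial
  is homogeneous over F_q; other \<open>c\<close> allow the first coefficient to be moved into
  F_q.\<close>

lemma trinomial_scale:
  assumes "r = c ^ (2 ^ h - 1)"
  shows "trinomial a b (c * x) = c * trinomial (a * conjg r) (b * r\<^sup>2) x"
  unfolding trinomial_alt assms
  by (simp only: power_mult_distrib conjg_mult mult_ac)

lemma bij_trinomial_scale:
  assumes "c \<noteq> 0" "r = c ^ (2 ^ h - 1)"
  shows "bij (trinomial a b) \<longleftrightarrow> bij (trinomial (a * conjg r) (b * r\<^sup>2))"
proof
  have bij: "bij (\<lambda>x. c * x)" "bij (\<lambda>x. x / c)"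
    using assms(1)
    by (auto simp: fun_eq_iff intro: o_bij[of "\<lambda>x. x / c" "\<lambda>x. c * x"]
        o_bij[of "\<lambda>x. c * x" "\<lambda>x. x / c"])
  note scale = trinomial_scale[OF assms(2), of a b]
  {
    assume "bij (trinomial a b)"
    then have "bij ((\<lambda>x. x / c) \<circ> trinomial a b \<circ> (\<lambda>x. c * x))"
      using bij by (intro bij_comp)
    then show "bij (trinomial (a * conjg r) (b * r\<^sup>2))"
      using assms(1) by (simp add: o_def scale)
  next
    assume "bij (trinomial (a * conjg r) (b * r\<^sup>2))"
    then have "bij ((\<lambda>x. c * x) \<circ> trinomial (a * conjg r) (b * r\<^sup>2) \<circ> (\<lambda>x. x / c))"
      using bij by (intro bij_comp)
    then show "bij (trinomial a b)"
      using assms(1) by (simp add: o_def flip: scale)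
  }
qed

text \<open>With \<open>u = x ^ (q - 1)\<close>, the value at \<open>x\<close> and its conjugate are
  \<open>x * D u / u\<close> and \<open>x * N u / u\<close>. Hence \<open>u\<close> determines the
  class of the value modulo F_q, and on each class homogeneity settles injectivity.
  Cross-multiplication absorbs the condition that \<open>D\<close> has no zero on
  \<open>mu\<close>.\<close>

lemma inj_trinomial_iff:
  fixes A B
  defines "N \<equiv> \<lambda>u. A * u ^ 3 + u\<^sup>2 + conjg B" and "D \<equiv> \<lambda>u. B * u ^ 3 + u + A"
  assumes A: "conjg A = A"
  shows "inj (trinomial A B) \<longleftrightarrow> (\<forall>u\<in>mu. \<forall>v\<in>mu. u \<noteq> v \<longrightarrow> N u * D v \<noteq> N v * D u)"
proof -
  have conj_D: "conjg (D u) = N u / u ^ 3" if u: "u \<in> mu" for u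
    using mu_nonzero[OF u]
    by (simp add: N_def D_def conjg_simps A mu_conjg[OF u])
      (simp add: field_simps power2_eq_square power3_eq_cube)
  have tri: "trinomial A B x = x * D (x ^ (2 ^ h - 1)) / x ^ (2 ^ h - 1)"
    and conj_tri: "conjg (trinomial A B x) = x * N (x ^ (2 ^ h - 1)) / x ^ (2 ^ h - 1)"
    if x: "x \<noteq> 0" for x
  proof -
    define u where "u = x ^ (2 ^ h - 1)"
    have u: "u \<in> mu" "u \<noteq> 0"
      unfolding u_def using power_q_minus_1_in_mu[OF x] mu_nonzero by blast+
    show t: "trinomial A B x = x * D (x ^ (2 ^ h - 1)) / x ^ (2 ^ h - 1)"
      unfolding trinomial_alt D_def u_def[symmetric]
      using u(2) by (simp add: mu_conjg[OF u(1)] field_simps power2_eq_square power3_eq_cube)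
    have "conjg x = x * u"
      using x unfolding u_def power_q_minus_1[OF x] by simp
    then show "conjg (trinomial A B x) = x * N (x ^ (2 ^ h - 1)) / x ^ (2 ^ h - 1)"
      unfolding t u_def[symmetric]
      using u mu_conjg[OF u(1)]
      by (simp add: conjg_mult conjg_divide conj_D power3_eq_cube)
  qed
  show ?thesis
  proof
    assume inj: "inj (trinomial A B)"
    show "\<forall>u\<in>mu. \<forall>v\<in>mu. u \<noteq> v \<longrightarrow> N u * D v \<noteq> N v * D u"
    proof (intro ballI impI notI)
      fix u v assume u: "u \<in> mu" and v: "v \<in> mu" and "u \<noteq> v" and eq: "N u * D v = N v * D u"
      obtain x where x: "x \<noteq> 0" "x ^ (2 ^ h - 1) = u"
        using mu_hilbert90[OF u] .
      obtain y where y: "y \<noteq> 0" "y ^ (2 ^ h - 1) = v"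
        using mu_hilbert90[OF v] .
      have "trinomial A B 0 = 0"
        by (simp add: trinomial_alt)
      then have nz: "trinomial A B x \<noteq> 0" "trinomial A B y \<noteq> 0"
        using inj_eq[OF inj, of x 0] inj_eq[OF inj, of y 0] x(1) y(1) by simp_all
      have nz': "u \<noteq> 0" "v \<noteq> 0"
        using u v mu_nonzero by auto
      \<comment> \<open>By the cross equation this ratio is fixed by \<open>conjg\<close>, so
        homogeneity gives \<open>c * x\<close> and \<open>y\<close> the same image.\<close>
      define c where "c = trinomial A B y / trinomial A B x"
      have c0: "c \<noteq> 0"
        using nz by (simp add: c_def)
      have "conjg (trinomial A B y) * trinomial A B x
          = (y * N v / v) * (x * D u / u)"
        unfolding tri[OF x(1)] conj_tri[OF y(1)] x(2) y(2) ..
      also have "\<dots> = (y * D v / v) * (x * N u / u)"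
        using eq by (simp add: mult_ac)
      also have "\<dots> = trinomial A B y * conjg (trinomial A B x)"
        unfolding tri[OF y(1)] conj_tri[OF x(1)] x(2) y(2) ..
      finally have "conjg (trinomial A B y) * trinomial A B x
          = trinomial A B y * conjg (trinomial A B x)" .
      then have "conjg c = c"
        using nz by (simp add: c_def conjg_divide field_simps conjg_eq_0_iff)
      then have c1: "c ^ (2 ^ h - 1) = 1"
        using c0 unfolding power_q_minus_1[OF c0] by simp
      then have "trinomial A B (c * x) = c * trinomial A B x"
        using trinomial_scale[OF c1[symmetric], of A B x] by (simp add: conjg_1)
      also have "\<dots> = trinomial A B y"
        using nz by (simp add: c_def)
      finally have "c * x = y"
        by (rule injD[OF inj])
      then have "y ^ (2 ^ h - 1) = c ^ (2 ^ h - 1) * x ^ (2 ^ h - 1)"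
        by (metis power_mult_distrib)
      then have "v = u"
        unfolding x(2) y(2) c1 by simp
      then show False
        using \<open>u \<noteq> v\<close> by simp
    qed
  next
    assume L: "\<forall>u\<in>mu. \<forall>v\<in>mu. u \<noteq> v \<longrightarrow> N u * D v \<noteq> N v * D u"
    have D_nz: "D u \<noteq> 0" if u: "u \<in> mu" for u
    proof
      assume "D u = 0"
      then have "N u = 0"
        using conj_D[OF u] mu_nonzero[OF u] by (simp add: conjg_0)
      obtain v where "v \<in> mu" "v \<noteq> u"
        using ex_mu_neq by blast
      with L u \<open>D u = 0\<close> \<open>N u = 0\<close> show False
        by auto
    qed
    have tri_nz: "trinomial A B x \<noteq> 0" if "x \<noteq> 0" for x
      unfolding tri[OF that]
      using D_nz[OF power_q_minus_1_in_mu[OF that]] mu_nonzero[OF power_q_minus_1_in_mu[OF that]]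
        that by simp
    have tri_0: "trinomial A B 0 = 0"
      by (simp add: trinomial_alt)
    show "inj (trinomial A B)"
    proof (rule injI)
      fix x y assume eq: "trinomial A B x = trinomial A B y"
      show "x = y"
      proof (cases "x = 0 \<or> y = 0")
        case True
        then show ?thesis
          using eq tri_nz tri_0 by metis
      next
        case False
        define u v where "u = x ^ (2 ^ h - 1)" and "v = y ^ (2 ^ h - 1)"
        have uv: "u \<in> mu" "v \<in> mu"
          unfolding u_def v_def using False power_q_minus_1_in_mu by blast+
        note nz = uv[THEN mu_nonzero] uv[THEN D_nz]
        have 1: "x * D u / u = y * D v / v"
          using eq False tri unfolding u_def v_def by metis
        have 2: "x * N u / u = y * N v / v"
          using eq False conj_tri unfolding u_def v_def by metis
        have "(x / u) * (y / v) * (N u * D v) = (x * N u / u) * (y * D v / v)"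
          by (simp add: mult_ac)
        also have "\<dots> = (y * N v / v) * (x * D u / u)"
          by (simp only: 1 2)
        also have "\<dots> = (x / u) * (y / v) * (N v * D u)"
          by (simp add: mult_ac)
        finally have "N u * D v = N v * D u"
          using False nz by simp
        then have "u = v"
          using L uv by blast
        then show ?thesis
          using 1 nz by simp
      qed
    qed
  qed
qed

text \<open>\<open>B'\<close> takes the place of \<open>conjg B\<close>, which makes this a purely
  algebraic identity. In characteristic 2 the sum is the cross difference, and \<open>1 + x\<close>
  is the factor coming from \<open>v = u\<close>.\<close>

lemma cross_difference_factor:
  fixes A B B' u x E :: 'a
  assumes E: "E = A\<^sup>2 + B * B'" and nz: "u \<noteq> 0" "x \<noteq> 0"
  shows "(A * u ^ 3 + u\<^sup>2 + B') * (B * (u * x) ^ 3 + u * x + A)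
      + (A * (u * x) ^ 3 + (u * x)\<^sup>2 + B') * (B * u ^ 3 + u + A)
    = u ^ 3 * x * (1 + x) * ((B * u\<^sup>2 + A * u + E) * x + (B' / u\<^sup>2 + A / u + E) / x
        + (A * (u + 1 / u) + E + 1))"
proof -
  have 1: "u ^ 3 * x * ((B * u\<^sup>2 + A * u + E) * x + (B' / u\<^sup>2 + A / u + E) / x
        + (A * (u + 1 / u) + E + 1))
    = u * ((B * u\<^sup>2 + A * u + E) * u\<^sup>2 * x\<^sup>2 + (B' + A * u + E * u\<^sup>2)
        + u * x * (A * (u\<^sup>2 + 1) + (E + 1) * u))"
    using nz by (simp add: field_simps power2_eq_square power3_eq_cube)
  have 2: "(A * u ^ 3 + u\<^sup>2 + B') * (B * (u * x) ^ 3 + u * x + A)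
      + (A * (u * x) ^ 3 + (u * x)\<^sup>2 + B') * (B * u ^ 3 + u + A)
    = (1 + x) * (u * ((B * u\<^sup>2 + A * u + E) * u\<^sup>2 * x\<^sup>2 + (B' + A * u + E * u\<^sup>2)
        + u * x * (A * (u\<^sup>2 + 1) + (E + 1) * u)))"
    unfolding E
    by (simp add: char_2_simps)
  show ?thesis
    unfolding 2 1[symmetric] by (simp only: mult_ac)
qed


text \<open>
  With \<open>v = u * x\<close>, the cofactor of \<open>u - v\<close> in \<open>N u * D v - N v * D u\<close> is, up to a unit,
  \<open>g u * x + conjg (g u) / x + b u\<close>.
\<close>

context
  fixes A B :: 'a
  assumes A_fixed: "conjg A = A" and A_nz: "A \<noteq> 0"
begin

definition E :: 'a where "E = A\<^sup>2 + B * conjg B"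
definition g :: "'a \<Rightarrow> 'a" where "g u = B * u\<^sup>2 + A * u + E"
definition b :: "'a \<Rightarrow> 'a" where "b u = A * (u + 1 / u) + E + 1"

lemma conjg_E: "conjg E = E"
  by (simp add: E_def conjg_simps A_fixed mult.commute)

lemma conjg_g: "u \<in> mu \<Longrightarrow> conjg (g u) = conjg B / u\<^sup>2 + A / u + E"
  by (simp add: g_def conjg_simps A_fixed conjg_E mu_conjg power_one_over)

lemma conjg_b: "u \<in> mu \<Longrightarrow> conjg (b u) = b u"
  by (simp add: b_def conjg_simps A_fixed conjg_E mu_conjg add.commute)

text \<open>Pairs \<open>(u, v)\<close> are rewritten as \<open>(u, u * x)\<close>, so that each
  \<open>u\<close> carries its own equation for \<open>x\<close>, settled by the two lemmas on
  conjugate equations.\<close>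

lemma bij_trinomial_iff:
  "bij (trinomial A B) \<longleftrightarrow> (\<forall>u\<in>mu. if b u = 0 then g u \<noteq> 0 \<and> conjg (g u) = g u
    else abs_trace h (g u * conjg (g u) / (b u)\<^sup>2) = 0)"
proof -
  define N where "N = (\<lambda>u. A * u ^ 3 + u\<^sup>2 + conjg B)"
  define D where "D = (\<lambda>u. B * u ^ 3 + u + A)"
  have factor: "N u * D (u * x) + N (u * x) * D u
      = u ^ 3 * x * (1 + x) * (g u * x + conjg (g u) / x + b u)"
    if "u \<in> mu" "x \<in> mu" for u x
    using cross_difference_factor[OF E_def that[THEN mu_nonzero]] conjg_g[OF that(1)]
    by (simp only: N_def D_def g_def b_def)
  have "bij (trinomial A B) \<longleftrightarrow> inj (trinomial A B)"
    using finite_UNIV_inj_surj[of "trinomial A B"] by (auto simp: bij_def)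
  also have "\<dots> \<longleftrightarrow> (\<forall>u\<in>mu. \<forall>v\<in>mu. u \<noteq> v \<longrightarrow> N u * D v \<noteq> N v * D u)"
    unfolding N_def D_def by (rule inj_trinomial_iff[OF A_fixed])
  also have "\<dots> \<longleftrightarrow> (\<forall>u\<in>mu. \<forall>x\<in>mu. x \<noteq> 1 \<longrightarrow> N u * D (u * x) \<noteq> N (u * x) * D u)"
    (is "?L = ?R")
  proof
    show ?R if ?L
      using that mu_nonzero mult_in_mu by auto
    show ?L if R: ?R
    proof (intro ballI impI)
      fix u v assume uv: "u \<in> mu" "v \<in> mu" "u \<noteq> v"
      have "v * (1 / u) \<in> mu" "v * (1 / u) \<noteq> 1" "u * (v * (1 / u)) = v"
        using uv mu_nonzero mult_in_mu[OF uv(2) inverse_in_mu] by auto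
      then show "N u * D v \<noteq> N v * D u"
        using R uv by metis
    qed
  qed
  also have "\<dots> \<longleftrightarrow> (\<forall>u\<in>mu. \<forall>x\<in>mu. x \<noteq> 1 \<longrightarrow> g u * x + conjg (g u) / x + b u \<noteq> 0)"
  proof (intro ball_cong refl imp_cong)
    fix u x assume ux: "u \<in> mu" "x \<in> mu" "x \<noteq> 1"
    then have "u ^ 3 * x * (1 + x) \<noteq> 0"
      using mu_nonzero by (auto simp: add_eq_0_iff_eq)
    then show "N u * D (u * x) \<noteq> N (u * x) * D u
        \<longleftrightarrow> g u * x + conjg (g u) / x + b u \<noteq> 0"
      using factor[OF ux(1,2)] by (metis add_eq_0_iff_eq mult_eq_0_iff)
  qed
  also have "\<dots> \<longleftrightarrow> (\<forall>u\<in>mu. if b u = 0 then g u \<noteq> 0 \<and> conjg (g u) = g u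
    else abs_trace h (g u * conjg (g u) / (b u)\<^sup>2) = 0)"
  proof (intro ball_cong refl)
    fix u assume u: "u \<in> mu"
    show "(\<forall>x\<in>mu. x \<noteq> 1 \<longrightarrow> g u * x + conjg (g u) / x + b u \<noteq> 0) \<longleftrightarrow>
      (if b u = 0 then g u \<noteq> 0 \<and> conjg (g u) = g u
       else abs_trace h (g u * conjg (g u) / (b u)\<^sup>2) = 0)"
      using conjugate_equation_on_mu_zero[of "g u"]
        conjugate_equation_on_mu_nonzero[OF _ conjg_b[OF u], of "g u"]
      by auto
  qed
  finally show ?thesis .
qed

section \<open>Sufficiency for a first coefficient in F_q\<close>

text \<open>With \<open>t = u + 1 / u + A\<close> in F_q one has \<open>b u = A * t\<close>, and the
  criterion's quotient differs from \<open>1 + 1 / A^2\<close> by \<open>(A / t)^2 + A / t\<close>,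
  of trace 0. At \<open>t = 0\<close> the value \<open>g u = A^2\<close> meets the side
  condition.\<close>

lemma bij_trinomial_if_eq_1:
  assumes B: "B = 1" and tr: "abs_trace h (1 + 1 / A\<^sup>2) = 0"
  shows "bij (trinomial A B)"
  unfolding bij_trinomial_iff
proof
  fix u assume u: "u \<in> mu"
  have u0: "u \<noteq> 0"
    using u by (rule mu_nonzero)
  define t where "t = u + 1 / u + A"
  have conj_t: "conjg t = t"
    by (simp add: t_def conjg_simps A_fixed mu_conjg[OF u] ac_simps)
  have E: "E = A\<^sup>2 + 1"
    unfolding E_def by (simp add: B conjg_1)
  have bu: "b u = A * t"
    by (simp add: b_def t_def E char_2_simps)
  have ut: "u * t = u\<^sup>2 + 1 + A * u"
    using u0 by (simp add: t_def field_simps power2_eq_square)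
  have gu: "g u = u * t + A\<^sup>2"
    unfolding ut g_def E by (simp add: B ac_simps)
  show "if b u = 0 then g u \<noteq> 0 \<and> conjg (g u) = g u
    else abs_trace h (g u * conjg (g u) / (b u)\<^sup>2) = 0"
  proof (cases "t = 0")
    case True
    then show ?thesis
      using A_nz by (simp add: bu gu conjg_power A_fixed)
  next
    case t: False
    have "g u * conjg (g u) = (u * t + A\<^sup>2) * (t / u + A\<^sup>2)"
      by (simp add: gu conjg_simps conj_t mu_conjg[OF u] A_fixed)
    also have "\<dots> = t\<^sup>2 + A\<^sup>2 * t * (u + 1 / u) + A ^ 4"
      using u0 by (simp add: field_simps power2_eq_square power4_eq_xxxx)
    also have "u + 1 / u = t + A"
      by (simp add: t_def add.assoc add_self)
    also have "t\<^sup>2 + A\<^sup>2 * t * (t + A) + A ^ 4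
      = (A * t)\<^sup>2 * ((1 + 1 / A\<^sup>2) + ((A / t)\<^sup>2 + A / t))"
      using A_nz t by (simp add: field_simps power2_eq_square power4_eq_xxxx)
    finally have "g u * conjg (g u) / (b u)\<^sup>2 = (1 + 1 / A\<^sup>2) + ((A / t)\<^sup>2 + A / t)"
      using A_nz t by (simp add: bu)
    moreover have "abs_trace h ((A / t)\<^sup>2 + A / t) = 0"
      by (rule abs_trace_square_add_self) (simp add: conjg_divide A_fixed conj_t)
    ultimately show ?thesis
      using A_nz t tr by (simp add: bu abs_trace_add)
  qed
qed

text \<open>For \<open>B\<close> in F_q the cubic condition factors as
  \<open>(B + 1) * (A^2 + B^2 + B) = 0\<close>.\<close>

lemma fixed_solutions:
  assumes "conjg B = B" "B * (E + 1) = A\<^sup>2"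
  shows "B = 1 \<or> A\<^sup>2 = B\<^sup>2 + B \<and> E = B"
proof -
  have "(B + 1) * (A\<^sup>2 + (B\<^sup>2 + B)) = 0"
    using arg_cong[OF assms(2), of "\<lambda>t. t + A\<^sup>2"] by (simp add: E_def assms(1) char_2_simps)
  then have "B = 1 \<or> A\<^sup>2 = B\<^sup>2 + B"
    by (auto simp: add_eq_0_iff_eq)
  then show ?thesis
    by (auto simp: E_def assms(1) char_2_simps)
qed

text \<open>The equation expresses \<open>B\<close> through \<open>A\<close> and \<open>E\<close>,
  so \<open>B\<close> is in F_q. Then \<open>A * (B * s + A) = B * b u\<close> makes the criterion's
  quotient constant in \<open>u\<close>.\<close>

lemma bij_trinomial_if_cubic:
  assumes B: "B * (E + 1) = A\<^sup>2" and norm: "B * conjg B \<noteq> 1"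
    and tr: "abs_trace h (B * conjg B / A\<^sup>2) = 0"
  shows "bij (trinomial A B)"
proof -
  have "B = A\<^sup>2 / (E + 1)"
    using B A_nz by (metis mult_zero_right nonzero_eq_divide_eq zero_eq_power2)
  then have B_fixed: "conjg B = B"
    using conjg_E by (metis conjg_simps(1,3,4,6) A_fixed)
  have B1: "B \<noteq> 1"
    using norm by (auto simp: conjg_1)
  then have A2: "A\<^sup>2 = B\<^sup>2 + B" and E: "E = B"
    using fixed_solutions[OF B_fixed B] by auto
  have B1': "B + 1 \<noteq> 0"
    using B1 by (simp add: add_eq_0_iff_eq)
  have A4: "A\<^sup>2 * A\<^sup>2 = B\<^sup>2 * (B + 1)\<^sup>2"
    unfolding A2 by (simp add: char_2_simps)
  show ?thesis
    unfolding bij_trinomial_iff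
  proof
    fix u assume u: "u \<in> mu"
    have u0: "u \<noteq> 0"
      using u by (rule mu_nonzero)
    define s where "s = u + 1 / u"
    have conj_s: "conjg s = s"
      by (simp add: s_def conjg_simps mu_conjg[OF u] add.commute)
    have bu: "b u = A * s + B + 1"
      by (simp add: b_def s_def E)
    have gu: "g u = u * (B * s + A)"
      using u0 by (simp add: g_def s_def E field_simps power2_eq_square)
    \<comment> \<open>A zero of \<open>b\<close> would make \<open>u / s\<close> an Artin-Schreier
      root of \<open>1 / s^2\<close> with \<open>conjg (u / s) + u / s = 1\<close>, although
      \<open>1 / s^2\<close> equals the trace-zero constant.\<close>
    have "b u \<noteq> 0"
    proof
      assume "b u = 0"
      then have As: "A * s = B + 1"
        by (simp add: bu add.assoc add_eq_0_iff_eq)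
      then have s: "s \<noteq> 0"
        using B1' by auto
      have "1 / s\<^sup>2 = A\<^sup>2 / (A * s)\<^sup>2"
        using A_nz by (simp add: power_mult_distrib)
      also have "\<dots> = B * conjg B / A\<^sup>2"
        unfolding As B_fixed using A4 A_nz B1'
        by (subst frac_eq_eq) (simp_all flip: power2_eq_square)
      finally have "abs_trace h (1 / s\<^sup>2) = 0"
        using tr by simp
      moreover have "(u / s)\<^sup>2 + u / s = 1 / s\<^sup>2"
      proof -
        have "u * s = u\<^sup>2 + 1"
          using u0 by (simp add: s_def field_simps power2_eq_square)
        then have "u\<^sup>2 + u * s = 1"
          by (simp add: add_self_left)
        moreover have "(u / s)\<^sup>2 + u / s = (u\<^sup>2 + u * s) / s\<^sup>2"
          using s by (simp add: field_simps power2_eq_square)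
        ultimately show ?thesis
          by simp
      qed
      ultimately have "conjg (u / s) + u / s = 0"
        using abs_trace_artin_schreier[of h "u / s"] by (simp add: conjg_def)
      moreover have "conjg (u / s) + u / s = (u + 1 / u) / s"
        by (simp add: conjg_divide conj_s mu_conjg[OF u] add_divide_distrib add.commute)
      then have "conjg (u / s) + u / s = 1"
        using s by (simp flip: s_def)
      ultimately show False
        by simp
    qed
    moreover have "g u * conjg (g u) / (b u)\<^sup>2 = B * conjg B / A\<^sup>2"
    proof -
      have "g u * conjg (g u) = (B * s + A)\<^sup>2"
        using u0
        by (simp add: gu conjg_simps mu_conjg[OF u] B_fixed A_fixed conj_s power2_eq_square)
      moreover have "A * (B * s + A) = B * b u"
        using A2 by (simp add: bu algebra_simps power2_eq_square)
      then have "A\<^sup>2 * (B * s + A)\<^sup>2 = B\<^sup>2 * (b u)\<^sup>2"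
        by (metis power_mult_distrib)
      ultimately show ?thesis
        using A_nz \<open>b u \<noteq> 0\<close> by (simp add: B_fixed field_simps power2_eq_square)
    qed
    ultimately show "if b u = 0 then g u \<noteq> 0 \<and> conjg (g u) = g u
      else abs_trace h (g u * conjg (g u) / (b u)\<^sup>2) = 0"
      using tr by simp
  qed
qed


section \<open>Necessity\<close>

text \<open>Here \<open>w\<close> is a zero of \<open>b\<close>, in \<open>mu\<close> or in F_q.
  Adding the two equations gives \<open>(B + conjg B) * (w + 1 / w)^2 = 0\<close>; afterwards
  \<open>w\<close> is eliminated through \<open>e(1)\<close>.\<close>

lemma fixed_of_conjugate_equations:
  assumes w: "w \<noteq> 0" and e: "A * (w + 1 / w) = E + 1" "E \<noteq> 1"
    and eq: "B * w\<^sup>2 + conjg B / w\<^sup>2 = E + 1" "B / w\<^sup>2 + conjg B * w\<^sup>2 = E + 1"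
  shows "conjg B = B \<and> B * (E + 1) = A\<^sup>2"
proof -
  have E1: "E + 1 \<noteq> 0"
    using e(2) by (simp add: add_eq_0_iff_eq)
  have e0: "w + 1 / w \<noteq> 0"
    using e(1) E1 by auto
  have "(B + conjg B) * (w + 1 / w)\<^sup>2
    = (B * w\<^sup>2 + conjg B / w\<^sup>2) + (B / w\<^sup>2 + conjg B * w\<^sup>2)"
    by (simp add: add_power2 power_one_over add_divide_distrib algebra_simps)
  also have "\<dots> = 0"
    by (simp only: eq add_self)
  finally have B: "conjg B = B"
    using e0 by (simp add: add_eq_0_iff_eq)
  have "B * (w + 1 / w)\<^sup>2 = E + 1"
    using eq(1) by (simp add: B add_power2 power_one_over algebra_simps)
  then have "B * (A * (w + 1 / w))\<^sup>2 = A\<^sup>2 * (E + 1)"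
    by (simp add: power_mult_distrib mult.left_commute)
  then have "B * (E + 1) * (E + 1) = A\<^sup>2 * (E + 1)"
    by (simp add: e(1) power2_eq_square mult.assoc)
  then show ?thesis
    using E1 B by simp
qed

text \<open>The conjugates of \<open>B * w^2 + A * w + E\<close> and
  \<open>B + A * w + E * w^2\<close> have a product that vanishes by the definition of
  \<open>E\<close>. So one of them is zero, by \<open>eq\<close> both are, and comparing them gives
  \<open>B = E\<close>.\<close>

lemma fixed_of_factor_equations:
  assumes w: "w \<noteq> 0" "w\<^sup>2 \<noteq> 1" "conjg w = w" and e: "A * (w + 1 / w) = E + 1" "E \<noteq> 1"
    and eq: "w\<^sup>2 * (B + A * w + E * w\<^sup>2) = conjg B * w\<^sup>2 + A * w + E"
  shows "conjg B = B \<and> B * (E + 1) = A\<^sup>2"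
proof -
  have Aw: "A * (w\<^sup>2 + 1) = (E + 1) * w"
    using e(1) w(1) by (simp add: field_simps power2_eq_square)
  have "(conjg B * w\<^sup>2 + A * w + E) * (conjg B + A * w + E * w\<^sup>2)
      = w\<^sup>2 * (A\<^sup>2 + B * conjg B + E)"
  proof -
    have "w\<^sup>2 * (B + A * w + E * w\<^sup>2) + (conjg B * w\<^sup>2 + A * w + E) = 0"
      unfolding eq by (rule add_self)
    also have "w\<^sup>2 * (B + A * w + E * w\<^sup>2) + (conjg B * w\<^sup>2 + A * w + E)
        = w\<^sup>2 * (B + conjg B) + w * (A * (w\<^sup>2 + 1)) + E * (w\<^sup>2 * w\<^sup>2 + 1)"
      by (simp add: algebra_simps power2_eq_square)
    finally have O: "w\<^sup>2 * (B + conjg B) + w * ((E + 1) * w) + E * (w\<^sup>2 * w\<^sup>2 + 1) = 0"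
      unfolding Aw .
    have "(conjg B * w\<^sup>2 + A * w + E) * (conjg B + A * w + E * w\<^sup>2)
        = (conjg B)\<^sup>2 * w\<^sup>2 + (conjg B * w + E * w) * (A * (w\<^sup>2 + 1))
          + conjg B * E * (w\<^sup>2 * w\<^sup>2 + 1) + A\<^sup>2 * w\<^sup>2 + E\<^sup>2 * w\<^sup>2"
      by (simp add: algebra_simps power2_eq_square)
    \<comment> \<open>The second summand is \<open>conjg B\<close> times the left side of
      \<open>O\<close>.\<close>
    also have "\<dots> = w\<^sup>2 * (A\<^sup>2 + B * conjg B + E)
        + conjg B * (w\<^sup>2 * (B + conjg B) + w * ((E + 1) * w) + E * (w\<^sup>2 * w\<^sup>2 + 1))"
      unfolding Aw by (simp add: char_2_simps)
    finally show ?thesis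
      unfolding O by simp
  qed
  also have "\<dots> = 0"
    by (simp add: E_def add_self)
  finally have "conjg B * w\<^sup>2 + A * w + E = 0 \<or> conjg (B + A * w + E * w\<^sup>2) = 0"
    by (simp add: conjg_simps A_fixed conjg_E w(3))
  then have n1: "B + A * w + E * w\<^sup>2 = 0"
    using eq w(1) by (auto simp: conjg_eq_0_iff)
  then have "conjg (conjg B * w\<^sup>2 + A * w + E) = 0"
    using eq by (simp add: conjg_0)
  then have n0: "B * w\<^sup>2 + A * w + E = 0"
    by (simp add: conjg_simps A_fixed conjg_E w(3))
  have "(B + E) * (w\<^sup>2 + 1) = (B + A * w + E * w\<^sup>2) + (B * w\<^sup>2 + A * w + E)"
    by (simp add: char_2_simps)
  then have "B = E"
    using w(2) by (simp add: n0 n1 add_eq_0_iff_eq)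
  have "B * (w\<^sup>2 + 1) + A * w = 0"
    using n0 unfolding \<open>B = E\<close>[symmetric] by (simp add: algebra_simps)
  then have "B * (w\<^sup>2 + 1) = A * w"
    by (simp only: add_eq_0_iff_eq)
  then have "w * (B * (E + 1)) = w * A\<^sup>2"
  proof -
    assume Bw: "B * (w\<^sup>2 + 1) = A * w"
    have "w * (B * (E + 1)) = B * (A * (w\<^sup>2 + 1))"
      unfolding Aw by (simp only: mult_ac)
    also have "\<dots> = A * (B * (w\<^sup>2 + 1))"
      by (rule mult.left_commute)
    also have "\<dots> = w * A\<^sup>2"
      unfolding Bw by (simp add: power2_eq_square)
    finally show ?thesis .
  qed
  then show ?thesis
    using w(1) conjg_E \<open>B = E\<close> by simp
qed


text \<open>The map sends 0 and infinity to the zeros \<open>w\<close> and \<open>1 / w\<close> of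
  \<open>b\<close> and preserves \<open>mu\<close> because \<open>w\<close> is in F_q. The
  numerators of \<open>\<kappa>0\<close> and \<open>\<kappa>1\<close> are \<open>g w\<close> and
  \<open>w^2 * g (1 / w)\<close>; the common denominator normalises the middle coefficient to
  1.\<close>

lemma moebius_image:
  assumes w: "w \<noteq> 0" "w\<^sup>2 \<noteq> 1" "conjg w = w" and e: "A * (w + 1 / w) = E + 1" "E \<noteq> 1"
    and y: "y \<in> mu" and u: "u = (y + w) / (1 + w * y)"
    and \<kappa>0: "\<kappa>0 = (B * w\<^sup>2 + A * w + E) / ((E + 1) * w)"
    and \<kappa>1: "\<kappa>1 = (B + A * w + E * w\<^sup>2) / ((E + 1) * w)"
  shows "u \<in> mu" "b u \<noteq> 0" "g u / b u = (\<kappa>1 * y + 1 + \<kappa>0 / y) * u / (w + 1 / w)"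
proof -
  have y0: "y \<noteq> 0"
    using y by (rule mu_nonzero)
  have E1: "E + 1 \<noteq> 0"
    using e(2) by (simp add: add_eq_0_iff_eq)
  have w21: "w\<^sup>2 + 1 \<noteq> 0"
    using w(2) by (simp add: add_eq_0_iff_eq)
  \<comment> \<open>F_q meets \<open>mu\<close> only in 1, which keeps the denominators below
    nonzero.\<close>
  have not_mu: "w \<notin> mu" "1 / w \<notin> mu"
    using w by (auto simp: mu_def conjg_simps power2_eq_square)
  have d1: "1 + w * y \<noteq> 0"
    using not_mu(2) y w(1) by (auto simp: add_eq_0_iff_eq field_simps)
      (metis nonzero_eq_divide_eq mult.commute)
  have d2: "y + w \<noteq> 0"
    using not_mu(1) y by (auto simp: add_eq_0_iff_eq)
  have u0: "u \<noteq> 0"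
    using d1 d2 by (simp add: u)
  have "conjg u = (1 / y + w) / (1 + w / y)"
    by (simp add: u conjg_simps w(3) mu_conjg[OF y])
  also have "\<dots> = ((1 / y + w) * y) / ((1 + w / y) * y)"
    using y0 by simp
  also have "\<dots> = (1 + w * y) / (y + w)"
    using y0 by (simp add: distrib_right)
  finally show u_mu: "u \<in> mu"
    using d1 d2 by (simp add: mu_def u)
  have Aw: "A * (w\<^sup>2 + 1) = (E + 1) * w"
    using e(1) w(1) by (simp add: field_simps power2_eq_square)
  have bu: "b u * ((1 + w * y) * (y + w)) = (E + 1) * (w\<^sup>2 + 1) * y"
  proof -
    have "b u * ((1 + w * y) * (y + w))
        = A * (y + w)\<^sup>2 + A * (1 + w * y)\<^sup>2 + (E + 1) * ((1 + w * y) * (y + w))"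
      using d1 d2 by (simp add: b_def u divide_simps) (simp add: algebra_simps power2_eq_square)
    also have "\<dots> = A * (w\<^sup>2 + 1) * (y\<^sup>2 + 1) + (E + 1) * ((1 + w * y) * (y + w))"
      by (simp add: char_2_simps)
    also have "\<dots> = (E + 1) * (w\<^sup>2 + 1) * y"
      unfolding Aw by (simp add: char_2_simps)
    finally show ?thesis .
  qed
  then show bu0: "b u \<noteq> 0"
    using E1 w21 y0 by auto
  have gu: "g u * (1 + w * y)\<^sup>2 = (E + 1) * w * (\<kappa>1 * y + 1 + \<kappa>0 / y) * y"
  proof -
    have "g u * (1 + w * y)\<^sup>2 = B * (y + w)\<^sup>2 + A * (y + w) * (1 + w * y) + E * (1 + w * y)\<^sup>2"
      using d1 by (simp add: g_def u divide_simps) (simp add: algebra_simps power2_eq_square)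
    also have "\<dots> = (B + A * w + E * w\<^sup>2) * y\<^sup>2 + A * (w\<^sup>2 + 1) * y + (B * w\<^sup>2 + A * w + E)"
      by (simp add: char_2_simps)
    also have "\<dots> = (E + 1) * w * \<kappa>1 * y\<^sup>2 + (E + 1) * w * y + (E + 1) * w * \<kappa>0"
      using E1 w(1) by (simp add: Aw \<kappa>0 \<kappa>1)
    also have "\<dots> = (E + 1) * w * (\<kappa>1 * y + 1 + \<kappa>0 / y) * y"
      using y0 by (simp add: field_simps power2_eq_square)
    finally show ?thesis .
  qed
  have uy: "u * (1 + w * y) = y + w"
    using d1 by (simp add: u)
  have ew: "(w + 1 / w) * w = w\<^sup>2 + 1"
    using w(1) by (simp add: distrib_right power2_eq_square)
  have e0: "w + 1 / w \<noteq> 0"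
    using ew w21 by auto
  let ?M = "\<kappa>1 * y + 1 + \<kappa>0 / y"
  have "(g u * (w + 1 / w)) * ((1 + w * y)\<^sup>2 * w * u)
      = (g u * (1 + w * y)\<^sup>2) * ((w + 1 / w) * w) * u"
    by (simp only: mult_ac)
  also have "\<dots> = ?M * u * ((E + 1) * (w\<^sup>2 + 1) * y) * w"
    unfolding gu ew by (simp only: mult_ac)
  also have "\<dots> = ?M * u * b u * ((1 + w * y) * (u * (1 + w * y))) * w"
    unfolding bu[symmetric] uy by (simp only: mult_ac)
  also have "\<dots> = (?M * u * b u) * ((1 + w * y)\<^sup>2 * w * u)"
    by (simp only: mult_ac power2_eq_square)
  finally have "g u * (w + 1 / w) = ?M * u * b u"
    using d1 w(1) u0 by simp
  then show "g u / b u = ?M * u / (w + 1 / w)"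
    using bu0 e0 by (simp add: frac_eq_eq)
qed

lemma bij_trinomial_imp_fixed:
  assumes bij: "bij (trinomial A B)"
  shows "E \<noteq> 1" "conjg B = B \<and> B * (E + 1) = A\<^sup>2"
proof -
  note crit = bij[unfolded bij_trinomial_iff, rule_format]
  show E: "E \<noteq> 1"
  proof
    assume E: "E = 1"
    \<comment> \<open>The side condition at this zero puts \<open>B\<close> into F_q, and then the
      nonzero \<open>g 1\<close> would have square \<open>E + 1 = 0\<close>.\<close>
    have "b 1 = 0"
      by (simp add: b_def E add_self)
    then have "g 1 \<noteq> 0" and "conjg (g 1) = g 1"
      using crit[OF one_in_mu] by auto
    moreover have g1: "g 1 = B + A + 1"
      by (simp add: g_def E)
    ultimately have "conjg B = B"
      by (simp add: conjg_simps A_fixed)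
    then have "(g 1)\<^sup>2 = E + 1"
      by (simp add: g1 E_def add_power2 ac_simps flip: power2_eq_square)
    then show False
      using \<open>g 1 \<noteq> 0\<close> by (simp add: E add_self)
  qed
  then have E1: "E + 1 \<noteq> 0"
    by (simp add: add_eq_0_iff_eq)
  \<comment> \<open>The zeros of \<open>b\<close> are the roots of \<open>w^2 + e * w + 1\<close>.
    Setting \<open>w = e * z\<close> gives an Artin-Schreier equation, and the trace of
    \<open>1 / e^2\<close> decides whether they lie in \<open>mu\<close> or in F_q.\<close>
  define e where "e = (E + 1) / A"
  have e0: "e \<noteq> 0" and Ae: "A * e = E + 1" and conj_e: "conjg e = e"
    using E1 A_nz by (simp_all add: e_def conjg_simps A_fixed conjg_E)
  have conj_e2: "conjg (1 / e\<^sup>2) = 1 / e\<^sup>2"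
    by (simp add: conjg_simps conj_e)
  obtain z where z: "z\<^sup>2 + z = 1 / e\<^sup>2" "conjg z + z = abs_trace h (1 / e\<^sup>2)"
    using ex_artin_schreier_root[OF conj_e2] by blast
  define w where "w = e * z"
  have ww: "w * (w + e) = 1"
  proof -
    have "w * (w + e) = e\<^sup>2 * (z\<^sup>2 + z)"
      by (simp add: w_def algebra_simps power2_eq_square)
    then show ?thesis
      using e0 by (simp add: z(1))
  qed
  then have w0: "w \<noteq> 0"
    by auto
  then have we: "w + e = 1 / w"
    using ww by (simp add: field_simps)
  then have ew: "w + 1 / w = e"
    by (metis add_self_left)
  have Aw: "A * (w + 1 / w) = E + 1"
    by (simp only: ew Ae)
  show "conjg B = B \<and> B * (E + 1) = A\<^sup>2"
  proof (cases "conjg z + z = 1")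
    case True
    then have "conjg z = z + 1"
      by (metis add.commute add_self_left)
    then have "conjg w = w + e"
      by (simp add: w_def conjg_mult conj_e distrib_left)
    then have w_mu: "w \<in> mu"
      by (simp add: mu_def ww)
    have eq: "B * v\<^sup>2 + conjg B / v\<^sup>2 = E + 1" if "v \<in> mu" "A * (v + 1 / v) = E + 1" for v
    proof -
      have "b v = 0"
        unfolding b_def that(2) by (simp add: char_2_simps)
      then have "g v = conjg (g v)"
        using crit[OF that(1)] by simp
      then have "B * v\<^sup>2 + A * v = conjg B / v\<^sup>2 + A / v"
        by (simp only: conjg_g[OF that(1)]) (simp add: g_def)
      then have "B * v\<^sup>2 + conjg B / v\<^sup>2 = A * v + A / v"
        by (simp only: add_swap)
      also have "\<dots> = E + 1"
        using that(2) by (simp add: distrib_left)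
      finally show ?thesis .
    qed
    have "B * w\<^sup>2 + conjg B / w\<^sup>2 = E + 1"
      by (rule eq[OF w_mu Aw])
    moreover have "B / w\<^sup>2 + conjg B * w\<^sup>2 = E + 1"
      using eq[OF inverse_in_mu[OF w_mu]] Aw by (simp add: power_one_over add.commute)
    ultimately show ?thesis
      by (rule fixed_of_conjugate_equations[OF w0 Aw E])
  next
    case False
    then have "conjg z = z"
      using abs_trace_dichotomy[OF conj_e2] z(2) by (auto simp: add_eq_0_iff_eq)
    then have w_fixed: "conjg w = w"
      by (simp add: w_def conjg_mult conj_e)
    have w2: "w\<^sup>2 \<noteq> 1"
    proof
      assume "w\<^sup>2 = 1"
      then have "w = 1"
        using power2_eq_iff[of w 1] by simp
      then show False
        using ew e0 by (simp add: add_self)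
    qed
    define \<kappa>0 where "\<kappa>0 = (B * w\<^sup>2 + A * w + E) / ((E + 1) * w)"
    define \<kappa>1 where "\<kappa>1 = (B + A * w + E * w\<^sup>2) / ((E + 1) * w)"
    \<comment> \<open>\<open>c1\<close> and \<open>c2\<close> are the coefficients of
      \<open>y\<close> and \<open>y^2\<close> in the transformed criterion.\<close>
    define c1 where "c1 = (\<kappa>1 + conjg \<kappa>0) / e\<^sup>2"
    define c2 where "c2 = \<kappa>1 * conjg \<kappa>0 / e\<^sup>2"
    have "c1\<^sup>2 = c2"
    proof (rule abs_trace_quadratic_on_mu)
      fix y assume y: "y \<in> mu"
      let ?M = "\<kappa>1 * y + 1 + \<kappa>0 / y"
      define u where "u = (y + w) / (1 + w * y)"
      note u = moebius_image[OF w0 w2 w_fixed Aw E y u_def \<kappa>0_def \<kappa>1_def]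
      have "g u * conjg (g u) / (b u)\<^sup>2 = (g u / b u) * conjg (g u / b u)"
        by (simp add: conjg_divide conjg_b[OF u(1)] power2_eq_square)
      \<comment> \<open>The factor \<open>u\<close> has norm one and cancels against its
        conjugate.\<close>
      also have "\<dots> = ?M * conjg ?M / e\<^sup>2"
        using mu_nonzero[OF u(1)]
        by (simp only: u(3) ew conjg_divide conjg_mult mu_conjg[OF u(1)] conj_e)
          (simp add: power2_eq_square)
      also have "conjg ?M = conjg \<kappa>1 / y + 1 + conjg \<kappa>0 * y"
        by (simp add: conjg_simps mu_conjg[OF y])
      also have "?M * (conjg \<kappa>1 / y + 1 + conjg \<kappa>0 * y) / e\<^sup>2
        = (\<kappa>1 * conjg \<kappa>1 + \<kappa>0 * conjg \<kappa>0 + 1) / e\<^sup>2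
          + c1 * y + conjg c1 / y + c2 * y\<^sup>2 + conjg c2 / y\<^sup>2"
        using e0 mu_nonzero[OF y]
        by (simp add: c1_def c2_def conjg_simps conj_e field_simps power2_eq_square)
      finally show "abs_trace h ((\<kappa>1 * conjg \<kappa>1 + \<kappa>0 * conjg \<kappa>0 + 1) / e\<^sup>2
          + c1 * y + conjg c1 / y + c2 * y\<^sup>2 + conjg c2 / y\<^sup>2) = 0"
        using crit[OF u(1)] u(2) by simp
    qed
    then have "(c1 * e\<^sup>2)\<^sup>2 = e\<^sup>2 * (c2 * e\<^sup>2)"
      by (simp add: power_mult_distrib power2_eq_square mult_ac)
    then have "(\<kappa>1 + conjg \<kappa>0)\<^sup>2 = e\<^sup>2 * (\<kappa>1 * conjg \<kappa>0)"
      using e0 by (simp add: c1_def c2_def)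
    also have "e\<^sup>2 = w\<^sup>2 + 1 / w\<^sup>2"
      by (simp add: add_power2 power_one_over flip: ew)
    finally have "w\<^sup>2 * (\<kappa>1 + conjg \<kappa>0)\<^sup>2 = w\<^sup>2 * (w\<^sup>2 + 1 / w\<^sup>2) * (\<kappa>1 * conjg \<kappa>0)"
      by (simp only: mult.assoc)
    also have "w\<^sup>2 * (w\<^sup>2 + 1 / w\<^sup>2) = w\<^sup>2 * w\<^sup>2 + 1"
      using w0 by (simp add: distrib_left)
    finally have *: "w\<^sup>2 * (\<kappa>1 + conjg \<kappa>0)\<^sup>2 = (w\<^sup>2 * w\<^sup>2 + 1) * (\<kappa>1 * conjg \<kappa>0)" .
    \<comment> \<open>Since \<open>e = w + 1 / w\<close>, the relation \<open>c1^2 = c2\<close>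
      splits into two linear factors.\<close>
    have "(\<kappa>1 + w\<^sup>2 * conjg \<kappa>0) * (w\<^sup>2 * \<kappa>1 + conjg \<kappa>0)
        = w\<^sup>2 * (\<kappa>1 + conjg \<kappa>0)\<^sup>2 + (w\<^sup>2 * w\<^sup>2 + 1) * (\<kappa>1 * conjg \<kappa>0)"
      by (simp add: char_2_simps)
    also have "\<dots> = 0"
      unfolding * by (rule add_self)
    finally have "(\<kappa>1 + w\<^sup>2 * conjg \<kappa>0) * (w\<^sup>2 * \<kappa>1 + conjg \<kappa>0) = 0" .
    then have disj: "\<kappa>1 = w\<^sup>2 * conjg \<kappa>0 \<or> w\<^sup>2 * \<kappa>1 = conjg \<kappa>0"
      by (simp add: add_eq_0_iff_eq)
    have n1: "\<kappa>1 * ((E + 1) * w) = B + A * w + E * w\<^sup>2"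
      using E1 w0 by (simp add: \<kappa>1_def)
    have n0: "conjg \<kappa>0 * ((E + 1) * w) = conjg B * w\<^sup>2 + A * w + E"
      using E1 w0 by (simp add: \<kappa>0_def conjg_simps A_fixed conjg_E w_fixed)
    have Aw': "A * (w\<^sup>2 + 1) = (E + 1) * w"
      using Aw w0 by (simp add: field_simps power2_eq_square)
    \<comment> \<open>The first alternative leads to the same pair of equations as the case of
      \<open>w\<close> in \<open>mu\<close>.\<close>
    from disj show ?thesis
    proof
      assume "\<kappa>1 = w\<^sup>2 * conjg \<kappa>0"
      then have "B + A * w + E * w\<^sup>2 = w\<^sup>2 * (conjg B * w\<^sup>2 + A * w + E)"
        using n1 n0 by (metis mult.assoc)
      then have "B + (A * w + E * w\<^sup>2)
          = conjg B * w\<^sup>2 * w\<^sup>2 + (w\<^sup>2 * (A * w) + E * w\<^sup>2)"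
        by (simp add: algebra_simps)
      then have "B + conjg B * w\<^sup>2 * w\<^sup>2 = w * (A * (w\<^sup>2 + 1))"
        by (subst (asm) add_swap) (simp add: char_2_simps)
      also have "\<dots> = (E + 1) * w\<^sup>2"
        unfolding Aw' by (simp add: power2_eq_square)
      finally have 1: "B / w\<^sup>2 + conjg B * w\<^sup>2 = E + 1"
        using w0 by (simp add: field_simps)
      have "B * w\<^sup>2 + conjg B / w\<^sup>2 = conjg (B / w\<^sup>2 + conjg B * w\<^sup>2)"
        by (simp add: conjg_simps w_fixed add.commute)
      also have "\<dots> = E + 1"
        by (simp add: 1 conjg_simps conjg_E)
      finally show ?thesis
        using 1 by (rule fixed_of_conjugate_equations[OF w0 Aw E])
    next
      assume "w\<^sup>2 * \<kappa>1 = conjg \<kappa>0"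
      then have "w\<^sup>2 * (B + A * w + E * w\<^sup>2) = conjg B * w\<^sup>2 + A * w + E"
        using n1 n0 by (metis mult.assoc)
      then show ?thesis
        by (rule fixed_of_factor_equations[OF w0 w2 w_fixed Aw E])
    qed
  qed
qed

text \<open>Once \<open>B\<close> is in F_q, the criterion at the single point \<open>u = 1\<close>
  supplies the trace condition of either family.\<close>

lemma bij_trinomial_imp_conditions:
  assumes bij: "bij (trinomial A B)"
  shows "B = 1 \<and> abs_trace h (1 + 1 / A\<^sup>2) = 0 \<or>
    B * (E + 1) = A\<^sup>2 \<and> B * conjg B \<noteq> 1 \<and> abs_trace h (B * conjg B / A\<^sup>2) = 0"
proof -
  note fixed = bij_trinomial_imp_fixed[OF bij]
  have "b 1 = E + 1"
    by (simp add: b_def add_self)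
  moreover have "E + 1 \<noteq> 0"
    using fixed(1) by (simp add: add_eq_0_iff_eq)
  moreover have "conjg (g 1) = g 1"
    using fixed(2) by (simp add: g_def conjg_simps A_fixed conjg_E)
  ultimately have tr: "abs_trace h ((g 1)\<^sup>2 / (E + 1)\<^sup>2) = 0"
    using bij[unfolded bij_trinomial_iff, rule_format, OF one_in_mu]
    by (simp add: power2_eq_square)
  have "B = 1 \<or> A\<^sup>2 = B\<^sup>2 + B \<and> E = B"
    using fixed(2) fixed_solutions by blast
  then show ?thesis
  proof
    assume B: "B = 1"
    have E: "E = A\<^sup>2 + 1"
      unfolding E_def by (simp add: B conjg_1)
    have "g 1 = A * (A + 1)"
      unfolding g_def E by (simp add: B char_2_simps)
    moreover have "E + 1 = A\<^sup>2"
      by (simp add: E add.assoc add_self)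
    moreover have "(A * (A + 1))\<^sup>2 / (A\<^sup>2)\<^sup>2 = 1 + 1 / A\<^sup>2"
      using A_nz by (simp add: power_mult_distrib add_power2)
        (simp add: field_simps power2_eq_square power4_eq_xxxx)
    ultimately show ?thesis
      using tr B by simp
  next
    assume AB: "A\<^sup>2 = B\<^sup>2 + B \<and> E = B"
    have B1: "B \<noteq> 1"
      using fixed(1) AB by auto
    then have "B + 1 \<noteq> 0"
      by (simp add: add_eq_0_iff_eq)
    have "A\<^sup>2 * A\<^sup>2 = B\<^sup>2 * (B + 1)\<^sup>2"
      unfolding conjunct1[OF AB] by (simp add: char_2_simps)
    then have "A\<^sup>2 / (B + 1)\<^sup>2 = B\<^sup>2 / A\<^sup>2"
      using A_nz \<open>B + 1 \<noteq> 0\<close> by (simp add: frac_eq_eq)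
    moreover have "g 1 = A"
      unfolding g_def conjunct2[OF AB] by (simp add: char_2_simps)
    moreover have "B\<^sup>2 \<noteq> 1"
      using B1 power2_eq_iff[of B 1] by simp
    ultimately show ?thesis
      using tr AB fixed(2) by (simp add: power2_eq_square)
  qed
qed

lemma bij_trinomial_fixed_iff:
  "bij (trinomial A B) \<longleftrightarrow>
    B = 1 \<and> abs_trace h (1 + 1 / A\<^sup>2) = 0 \<or>
    B * (1 + A\<^sup>2 + B * conjg B) = A\<^sup>2 \<and> B * conjg B \<noteq> 1
      \<and> abs_trace h (B * conjg B / A\<^sup>2) = 0"
proof -
  have "1 + A\<^sup>2 + B * conjg B = E + 1"
    by (simp add: E_def ac_simps)
  then show ?thesis
    using bij_trinomial_imp_conditions bij_trinomial_if_eq_1 bij_trinomial_if_cubic by metis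
qed

end

section \<open>Rescaling a general first coefficient into F_q\<close>

lemma bij_trinomial_iff_cases:
  assumes a0: "\<alpha> \<noteq> 0"
  shows "bij (trinomial \<alpha> \<beta>) \<longleftrightarrow>
    \<beta> = conjg \<alpha> / \<alpha> \<and> abs_trace h (1 + 1 / (\<alpha> * conjg \<alpha>)) = 0 \<or>
    \<beta> * (1 + \<alpha> * conjg \<alpha> + \<beta> * conjg \<beta>) + (conjg \<alpha>)\<^sup>2 = 0 \<and> \<beta> * conjg \<beta> \<noteq> 1
      \<and> abs_trace h (\<beta> * conjg \<beta> / (\<alpha> * conjg \<alpha>)) = 0"
proof -
  have ca0: "conjg \<alpha> \<noteq> 0"
    using a0 by (simp add: conjg_eq_0_iff)
  \<comment> \<open>For \<open>r\<close> in \<open>mu\<close>, the rescaled coefficient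
    \<open>\<alpha> / r\<close> is fixed by \<open>conjg\<close> exactly when
    \<open>r^2 = \<alpha> / conjg \<alpha>\<close>.\<close>
  obtain r where r2: "r\<^sup>2 = \<alpha> / conjg \<alpha>"
    using ex_sqrt by blast
  have "(r * conjg r)\<^sup>2 = r\<^sup>2 * conjg (r\<^sup>2)"
    by (simp add: power_mult_distrib conjg_power)
  also have "\<dots> = 1\<^sup>2"
    using a0 ca0 by (simp add: r2 conjg_simps)
  finally have r: "r \<in> mu"
    by (simp only: power2_eq_iff mu_def mem_Collect_eq)
  then obtain c where c: "c \<noteq> 0" "c ^ (2 ^ h - 1) = r"
    using mu_hilbert90 by blast
  have r0: "r \<noteq> 0"
    using r by (rule mu_nonzero)
  define A B where "A = \<alpha> * conjg r" and "B = \<beta> * r\<^sup>2"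
  have "conjg A = conjg \<alpha> * r\<^sup>2 / r"
    using r0 by (simp add: A_def conjg_simps power2_eq_square)
  also have "\<dots> = A"
    using ca0 by (simp add: r2 A_def mu_conjg[OF r])
  finally have A_fixed: "conjg A = A" .
  have A0: "A \<noteq> 0"
    using a0 r0 by (simp add: A_def conjg_eq_0_iff)
  have A2: "A\<^sup>2 = \<alpha> * conjg \<alpha>"
  proof -
    have "A\<^sup>2 = \<alpha>\<^sup>2 / r\<^sup>2"
      by (simp add: A_def mu_conjg[OF r] power_divide)
    also have "\<dots> = \<alpha> * conjg \<alpha>"
      unfolding r2 using a0 ca0 by (simp add: power2_eq_square)
    finally show ?thesis .
  qed
  have BB: "B * conjg B = \<beta> * conjg \<beta>"
    using r0 by (simp add: B_def conjg_simps mu_conjg[OF r] power_one_over)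
  have B1: "B = 1 \<longleftrightarrow> \<beta> = conjg \<alpha> / \<alpha>"
    using a0 ca0 by (auto simp: B_def r2 field_simps)
  have "B * (1 + A\<^sup>2 + B * conjg B) + A\<^sup>2
      = r\<^sup>2 * (\<beta> * (1 + \<alpha> * conjg \<alpha> + \<beta> * conjg \<beta>) + (conjg \<alpha>)\<^sup>2)"
  proof -
    have "A\<^sup>2 = r\<^sup>2 * (conjg \<alpha>)\<^sup>2"
      unfolding A2 r2 using ca0 by (simp add: power2_eq_square)
    then have "B * (1 + A\<^sup>2 + B * conjg B) + A\<^sup>2
      = B * (1 + \<alpha> * conjg \<alpha> + \<beta> * conjg \<beta>) + r\<^sup>2 * (conjg \<alpha>)\<^sup>2"
      by (simp only: BB) (simp only: A2)
    then show ?thesis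
      by (simp only: B_def distrib_left mult_ac)
  qed
  then have B2: "B * (1 + A\<^sup>2 + B * conjg B) = A\<^sup>2 \<longleftrightarrow>
      \<beta> * (1 + \<alpha> * conjg \<alpha> + \<beta> * conjg \<beta>) + (conjg \<alpha>)\<^sup>2 = 0"
    using r0 by (metis add_eq_0_iff_eq mult_eq_0_iff zero_eq_power2)
  have "bij (trinomial \<alpha> \<beta>) \<longleftrightarrow> bij (trinomial A B)"
    unfolding A_def B_def using c(1) c(2)[symmetric] by (rule bij_trinomial_scale)
  then show ?thesis
    unfolding bij_trinomial_fixed_iff[OF A_fixed A0] B1 B2 unfolding A2 BB .
qed

end

theorem theorem2:
  fixes h :: nat and \<alpha> \<beta> :: "'a::{field,finite}"
  defines "q \<equiv> (2::nat) ^ h"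
  assumes h3: "h \<ge> 3"
    and card: "card (UNIV :: 'a set) = q ^ 2"
    and a0: "\<alpha> \<noteq> 0" and b0: "\<beta> \<noteq> 0"
  shows "bij (\<lambda>x::'a. x + \<alpha> * x ^ (q * (q - 1) + 1) + \<beta> * x ^ (2 * (q - 1) + 1))
     \<longleftrightarrow>
     ((\<beta> = \<alpha> ^ (q - 1) \<and> abs_trace h (1 + 1 / \<alpha> ^ (q + 1)) = 0)
      \<or> (\<beta> * (1 + \<alpha> ^ (q + 1) + \<beta> ^ (q + 1)) + \<alpha> ^ (2 * q) = 0
         \<and> \<beta> ^ (q + 1) \<noteq> 1
         \<and> abs_trace h (\<beta> ^ (q + 1) / \<alpha> ^ (q + 1)) = 0))"
proof -
  interpret quadratic_ext_char_2 h "TYPE('a)"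
    using h3 card by unfold_locales (simp_all add: q_def)
  have tri: "(\<lambda>x. x + \<alpha> * x ^ (q * (q - 1) + 1) + \<beta> * x ^ (2 * (q - 1) + 1)) = trinomial \<alpha> \<beta>"
    by (rule ext) (simp only: trinomial_def q_def)
  have norm: "x ^ (q + 1) = x * conjg x" for x :: 'a
    by (simp add: conjg_def q_def)
  have quot: "\<alpha> ^ (q - 1) = conjg \<alpha> / \<alpha>"
    unfolding q_def using a0 by (rule power_q_minus_1)
  have sq: "\<alpha> ^ (2 * q) = (conjg \<alpha>)\<^sup>2"
    by (simp add: conjg_def q_def mult.commute flip: power_mult)
  show ?thesis
    unfolding tri norm quot sq by (rule bij_trinomial_iff_cases[OF a0])
qed

end
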